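(* Let $(a,b),(c,d)\in Z(\mathbb{S})$ be such that $(a,b)(c,d)=0$ and $n(a)=n(b)=n(c)=n(d)=1$, and define \begin{align*} f_0&=(1,0), & f_4&=(ac,-ad), & \tilde f_0&=(0,1), & \tilde f_4&=(ad,ac),\\ f_1&=(a,b), & f_5&=(c,d), & \tilde f_1&=(-b,a), & \tilde f_5&=(-d,c),\\ f_2&=(c,-d), & f_6&=(a,-b), & \tilde f_2&=(d,c), & \tilde f_6&=(b,a),\\ f_3&=(ac,ad), & f_7&=(0,ab), & \tilde f_3&=(-ad,ac), & \tilde f_7&=(-ab,0). \end{align*} Then the following are subalgebras of $\mathbb{S}$ which contain $f_1$, with the indicated isomorphism ($\cong$) or conjugacy ($\sim$) relations. Dimension $3$: $\mathrm{Lin}(f_0,f_1,f_4)\sim S_3$, $\mathrm{Lin}(f_0,f_1,f_5)\sim S_3$, $\mathrm{Lin}(f_0,f_1,\tilde f_4)\sim S_3$, $\mathrm{Lin}(f_0,f_1,\tilde f_5)\sim S_3$. Dimension $4$: $\mathrm{Lin}(f_0,f_1,f_6,f_7)\cong\mathbb{H}$, $\mathrm{Lin}(f_0,f_1,\tilde f_0,\tilde f_1)\cong\mathbb{H}$, $\mathrm{Lin}(f_0,f_1,\tilde f_6,\tilde f_7)\cong\mathbb{H}$, $\mathrm{Lin}(f_0,f_1,f_2,f_3)\sim S_4$. Dimension $6$: $\mathrm{Lin}(f_0,f_1,f_4,\tilde f_0,\tilde f_1,\tilde f_4)\sim S_6$, $\mathrm{Lin}(f_0,f_1,f_5,\tilde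 f_0,\tilde f_1,\tilde f_5)\sim S_6$. Dimension $8$: $\mathrm{Lin}(f_0,f_1,f_2,f_3,f_4,f_5,f_6,f_7)\sim S_8$, $\mathrm{Lin}(f_0,f_1,f_6,f_7,\tilde f_2,\tilde f_3,\tilde f_4,\tilde f_5)\sim S_8$, $\mathrm{Lin}(f_0,f_1,f_6,f_7,\tilde f_0,\tilde f_1,\tilde f_6,\tilde f_7)\sim\mathbb{O}_{i,j,e}$, $\mathrm{Lin}(f_0,f_1,f_2,f_3,\tilde f_0,\tilde f_1,\tilde f_2,\tilde f_3)\sim R_8$.
   Context: Cayley-Dickson conventions. Let $\mathcal{M}_0=\mathbb{R}$ with trivial involution and basis $e^{(0)}_0=1$, and let $\mathcal{M}_{n+1}=\mathcal{M}_n\times\mathcal{M}_n$ with componentwise real vector space structure, product $(a,b)(c,d)=(ac-\bar d b,\ da+b\bar c)$, involution $\overline{(a,b)}=(\bar a,-b)$, and basis $e^{(n+1)}_m=(e^{(n)}_m,0)$ for $0\le m<2^n$, $e^{(n+1)}_m=(0,e^{(n)}_{m-2^n})$ for $2^n\le m<2^{n+1}$. The quaternions, octonions and sedenions are $\mathbb{H}=\mathcal{M}_2$, $\mathbb{O}=\mathcal{M}_3$, $\mathbb{S}=\mathcal{M}_4$; a sedenion is a pair of octonions. The basis of $\mathbb{O}$ is written $1,e_1,\dots,e_7$. The algebras embed as $\mathbb{H}\subset\mathbb{O}\subset\mathbb{S}$ via $x\mapsto(x,0)$, so $\mathbb{H}\subset\mathbb{S}$ is spanned by $(1,0),(e_1,0),(e_2,0),(e_3,0)$.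 The norm is $n(x)=x\bar x=\bar xx\in\mathbb{R}$ (no square root). $Z(\mathbb{S})$ denotes the set of zero divisors, i.e. nonzero $u\in\mathbb{S}$ for which there is a nonzero $v\in\mathbb{S}$ with $uv=0$ or $vu=0$. $\mathrm{Lin}$ denotes real linear span. For subalgebras $S_1,S_2\subseteq\mathbb{S}$, $S_1\cong S_2$ means isomorphic as real algebras, and $S_1\sim S_2$ (conjugate) means that some automorphism in $\mathrm{Aut}_{\mathbb{R}}(\mathbb{S})$ maps $S_1$ onto $S_2$. The reference subalgebras are $$S_3=\mathrm{Lin}((1,0),(e_1,e_4),(e_2,e_7)),\quad S_4=\mathrm{Lin}((1,0),(e_1,e_2),(e_4,e_7),(e_5,-e_6)),$$ $$S_6=S_3+S_3(0,1),\quad S_8=\mathbb{H}+\mathbb{H}(0,e_4),\quad \mathbb{O}_{i,j,e}=\mathbb{H}+\mathbb{H}(0,1),\quad R_8=S_4+S_4(0,1),$$ where $X u=\{xu\mid x\in X\}$. *)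

theory Defs
  imports "HOL-Analysis.Analysis"
begin

record 'a cd_algebra =
  cd_mult :: "'a \<Rightarrow> 'a \<Rightarrow> 'a"  (infixl "\<odot>\<index>" 70)
  cd_cnj :: "'a \<Rightarrow> 'a"
  cd_basis :: "nat \<Rightarrow> 'a"

text \<open>
  The componentwise real vector space structure on pairs is the one of the library.
  In the basis of the double, \<open>DIM('a)\<close> plays the role of \<open>2\<^sup>n\<close>, and \<open>cd_basis A m\<close> is only
  meaningful for \<open>m < DIM('a)\<close>.
\<close>

definition cd_double :: "'a::euclidean_space cd_algebra \<Rightarrow> ('a \<times> 'a) cd_algebra" where
  "cd_double A =
    \<lparr>cd_mult = (\<lambda>(a, b) (c, d).
        (a \<odot>\<^bsub>A\<^esub> c - cd_cnj A d \<odot>\<^bsub>A\<^esub> b, d \<odot>\<^bsub>A\<^esub> a + b \<odot>\<^bsub>A\<^esub> cd_cnj A c)),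
     cd_cnj = (\<lambda>(a, b). (cd_cnj A a, - b)),
     cd_basis = (\<lambda>m. if m < DIM('a) then (cd_basis A m, 0) else (0, cd_basis A (m - DIM('a))))\<rparr>"

type_synonym quaternion = "(real \<times> real) \<times> (real \<times> real)"
type_synonym octonion = "quaternion \<times> quaternion"
type_synonym sedenion = "octonion \<times> octonion"

definition M0 :: "real cd_algebra" where
  "M0 = \<lparr>cd_mult = (*), cd_cnj = (\<lambda>x. x), cd_basis = (\<lambda>m. 1)\<rparr>"

definition M1 :: "(real \<times> real) cd_algebra" where "M1 = cd_double M0"
definition M2 :: "quaternion cd_algebra" where "M2 = cd_double M1"
definition M3 :: "octonion cd_algebra" where "M3 = cd_double M2"
definition M4 :: "sedenion cd_algebra" where "M4 = cd_double M3"

definition cd_one :: "'a cd_algebra \<Rightarrow> 'a" where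
  "cd_one A = cd_basis A 0"

text \<open>
  The norm is a real number in the sense of the embedding \<open>r \<mapsto> r 1\<close> of the reals
  into the algebra; see \<open>cd_norm_M3\<close> below.
\<close>

definition cd_norm :: "'a cd_algebra \<Rightarrow> 'a \<Rightarrow> 'a" where
  "cd_norm A x = x \<odot>\<^bsub>A\<^esub> cd_cnj A x"

definition zero_divisors :: "'a::zero cd_algebra \<Rightarrow> 'a set" where
  "zero_divisors A = {u. u \<noteq> 0 \<and> (\<exists>v. v \<noteq> 0 \<and> (u \<odot>\<^bsub>A\<^esub> v = 0 \<or> v \<odot>\<^bsub>A\<^esub> u = 0))}"

definition cd_subalgebra :: "'a::real_vector cd_algebra \<Rightarrow> 'a set \<Rightarrow> bool" where
  "cd_subalgebra A V \<longleftrightarrow> subspace V \<and> (\<forall>x\<in>V. \<forall>y\<in>V. x \<odot>\<^bsub>A\<^esub> y \<in> V)"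

definition cd_aut :: "'a::real_vector cd_algebra \<Rightarrow> ('a \<Rightarrow> 'a) set" where
  "cd_aut A = {\<phi>. bij \<phi> \<and> linear \<phi> \<and> (\<forall>x y. \<phi> (x \<odot>\<^bsub>A\<^esub> y) = \<phi> x \<odot>\<^bsub>A\<^esub> \<phi> y)}"

definition cd_conjugate :: "'a::real_vector cd_algebra \<Rightarrow> 'a set \<Rightarrow> 'a set \<Rightarrow> bool" where
  "cd_conjugate A V W \<longleftrightarrow> (\<exists>\<phi>\<in>cd_aut A. \<phi> ` V = W)"

definition cd_isomorphic :: "'a::real_vector cd_algebra \<Rightarrow> 'a set \<Rightarrow> 'a set \<Rightarrow> bool" where
  "cd_isomorphic A V W \<longleftrightarrow>
    (\<exists>\<phi>. bij_betw \<phi> V W \<and>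
      (\<forall>x\<in>V. \<forall>y\<in>V. \<phi> (x + y) = \<phi> x + \<phi> y) \<and>
      (\<forall>r. \<forall>x\<in>V. \<phi> (r *\<^sub>R x) = r *\<^sub>R \<phi> x) \<and>
      (\<forall>x\<in>V. \<forall>y\<in>V. \<phi> (x \<odot>\<^bsub>A\<^esub> y) = \<phi> x \<odot>\<^bsub>A\<^esub> \<phi> y))"

abbreviation (input) sed_sim :: "sedenion set \<Rightarrow> sedenion set \<Rightarrow> bool"  (infix "\<sim>\<^sub>S" 50) where
  "V \<sim>\<^sub>S W \<equiv> cd_conjugate M4 V W"

abbreviation (input) sed_iso :: "sedenion set \<Rightarrow> sedenion set \<Rightarrow> bool"  (infix "\<cong>\<^sub>S" 50) where
  "V \<cong>\<^sub>S W \<equiv> cd_isomorphic M4 V W"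

abbreviation oct_e :: "nat \<Rightarrow> octonion" where
  "oct_e \<equiv> cd_basis M3"

text \<open>\<open>plus_translate X u\<close> is \<open>X + X u\<close>.\<close>

definition plus_translate :: "sedenion set \<Rightarrow> sedenion \<Rightarrow> sedenion set" where
  "plus_translate X u = {x + y \<odot>\<^bsub>M4\<^esub> u | x y. x \<in> X \<and> y \<in> X}"

definition sed_H :: "sedenion set" where
  "sed_H = range (\<lambda>x :: quaternion. ((x, 0), 0))"

definition S_3 :: "sedenion set" where
  "S_3 = span {(cd_one M3, 0), (oct_e 1, oct_e 4), (oct_e 2, oct_e 7)}"

definition S_4 :: "sedenion set" where
  "S_4 = span {(cd_one M3, 0), (oct_e 1, oct_e 2), (oct_e 4, oct_e 7), (oct_e 5, - oct_e 6)}"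

definition S_6 :: "sedenion set" where
  "S_6 = plus_translate S_3 (0, cd_one M3)"

definition S_8 :: "sedenion set" where
  "S_8 = plus_translate sed_H (0, oct_e 4)"

definition O_ije :: "sedenion set" where
  "O_ije = plus_translate sed_H (0, cd_one M3)"

definition R_8 :: "sedenion set" where
  "R_8 = plus_translate S_4 (0, cd_one M3)"

lemmas cd_simps =
  M4_def M3_def M2_def M1_def M0_def cd_double_def cd_one_def cd_norm_def

lemma cd_one_M3: "cd_one M3 \<odot>\<^bsub>M3\<^esub> x = x" "x \<odot>\<^bsub>M3\<^esub> cd_one M3 = x"
  by (cases x; auto simp: cd_simps zero_prod_def)+

lemma cd_one_M4: "(cd_one M3, 0) \<odot>\<^bsub>M4\<^esub> x = x" "x \<odot>\<^bsub>M4\<^esub> (cd_one M3, 0) = x"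
  by (cases x; auto simp: cd_simps zero_prod_def)+

lemma cd_norm_M3:
  "cd_norm M3 x = (x \<bullet> x) *\<^sub>R cd_one M3"
  "cd_cnj M3 x \<odot>\<^bsub>M3\<^esub> x = (x \<bullet> x) *\<^sub>R cd_one M3"
  by (cases x; auto simp: cd_simps zero_prod_def algebra_simps)+

lemma sed_H_eq_span: "sed_H = span ((\<lambda>m. (oct_e m, 0)) ` {0, 1, 2, 3})"
proof
  show "sed_H \<subseteq> span ((\<lambda>m. (oct_e m, 0)) ` {0, 1, 2, 3})"
  proof
    fix y assume "y \<in> sed_H"
    then obtain p q r s where y: "y = ((((p, q), (r, s)), 0), 0)"
      by (auto simp: sed_H_def)
    have "y = p *\<^sub>R (oct_e 0, 0) + q *\<^sub>R (oct_e 1, 0) + r *\<^sub>R (oct_e 2, 0) + s *\<^sub>R (oct_e 3, 0)"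
      by (simp add: y cd_simps zero_prod_def)
    also have "\<dots> \<in> span ((\<lambda>m. (oct_e m, 0)) ` {0, 1, 2, 3})"
      by (intro span_add span_scale span_base) auto
    finally show "y \<in> span ((\<lambda>m. (oct_e m, 0)) ` {0, 1, 2, 3})" .
  qed
  have "subspace sed_H"
    by (auto simp: sed_H_def subspace_def image_iff zero_prod_def)
  moreover have "(oct_e m, 0) \<in> sed_H" if "m \<in> {0, 1, 2, 3}" for m
    using that by (auto simp: sed_H_def cd_simps zero_prod_def)
  ultimately show "span ((\<lambda>m. (oct_e m, 0)) ` {0, 1, 2, 3}) \<subseteq> sed_H"
    by (intro span_minimal) auto
qed

end

theory Submission
  imports Defs
begin

text \<open>
  The octonion identity \<open>(x y) z = - x (y z)\<close> is behind every zero product of sedenions: if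
  \<open>(a, b) (c, d) = 0\<close> with all four octonions of norm \<open>1\<close>, eliminating \<open>d\<close> leaves
  \<open>(a e) b = - a (e b)\<close> for \<open>e = c b\<^bsup>*\<^esup>\<close>. The associator of three units has norm at most \<open>2\<close>, and
  the bound is attained only by imaginary units \<open>x\<close>, \<open>y\<close>, \<open>z\<close> that are orthogonal to each other,
  with \<open>y\<close> orthogonal to \<open>x z\<close> as well
  (\<open>anti_associative_basic_triple\<close>). So \<open>a\<close>, \<open>b\<close>, \<open>c\<close> form a basic triple, and
  \<open>d = (a c) b\<close> is determined by them (\<open>zero_product_basic_triple\<close>).

  The automorphisms of the octonions act transitively on basic triples (\<open>basic_triple_hom\<close>):
  repeated Cayley-Dickson doubling inside the octonions produces an automorphism \<open>\<phi>\<close> with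
  \<open>\<phi> e\<^sub>1 = a\<close>, \<open>\<phi> e\<^sub>2 = b\<close>, \<open>\<phi> e\<^sub>4 = c\<close>. Applied to both components, \<open>\<phi>\<close> is an automorphism of
  the sedenions. It identifies the given zero product with the standard one,
  \<open>(e\<^sub>1, e\<^sub>2) (e\<^sub>4, - e\<^sub>7) = 0\<close>, and every \<open>f\<^sub>i\<close> with a fixed pair of octonions that are zero or
  basis elements up to sign.

  What remains is finite. In the standard situation, three of the spans are \<open>S_4\<close>, \<open>O_ije\<close> and \<open>R_8\<close>
  themselves. The others that are claimed to be conjugate to a reference subalgebra are taken to
  it by signed permutations of the octonion basis. The remaining three spans have a quaternion
  multiplication table after a change of basis. Subalgebra property and dimension are
  computed for the reference subalgebras and carried over by conjugacy.
\<close>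

section \<open>The Cayley-Dickson algebras in coordinates\<close>

lemma cd_double_simps:
  "(a, b) \<odot>\<^bsub>cd_double A\<^esub> (c, d) =
     (a \<odot>\<^bsub>A\<^esub> c - cd_cnj A d \<odot>\<^bsub>A\<^esub> b, d \<odot>\<^bsub>A\<^esub> a + b \<odot>\<^bsub>A\<^esub> cd_cnj A c)"
  "cd_cnj (cd_double A) (a, b) = (cd_cnj A a, - b)"
  "cd_one (cd_double A) = (cd_one A, 0)"
  by (simp_all add: cd_double_def cd_one_def)

lemma M0_simps: "x \<odot>\<^bsub>M0\<^esub> y = x * y" "cd_cnj M0 x = x" "cd_one M0 = 1"
  by (simp_all add: M0_def cd_one_def)

lemmas M1_simps = cd_double_simps[of M0, folded M1_def]
  and M2_simps = cd_double_simps[of M1, folded M2_def]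
  and M3_simps = cd_double_simps[of M2, folded M3_def]
  and M4_simps = cd_double_simps[of M3, folded M4_def]

lemmas cd_coords = M4_simps M3_simps M2_simps M1_simps M0_simps zero_prod_def

abbreviation omult :: "octonion \<Rightarrow> octonion \<Rightarrow> octonion"  (infixl "\<star>" 70) where
  "x \<star> y \<equiv> x \<odot>\<^bsub>M3\<^esub> y"

abbreviation ocnj :: "octonion \<Rightarrow> octonion" where "ocnj \<equiv> cd_cnj M3"

abbreviation oone :: octonion where "oone \<equiv> cd_one M3"

text \<open>
  Conjugation has to be carried along because it enters the product of the double.
\<close>
lemma bilinear_cd_double:
  assumes "bilinear (cd_mult A)" "linear (cd_cnj A)"
  shows "bilinear (cd_mult (cd_double A))" "linear (cd_cnj (cd_double A))"
proof -
  note bil = bilinear_ladd[OF assms(1)] bilinear_radd[OF assms(1)]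
    bilinear_lmul[OF assms(1)] bilinear_rmul[OF assms(1)]
  note lin = linear_add[OF assms(2)] linear_scale[OF assms(2)]
  show "bilinear (cd_mult (cd_double A))"
    unfolding bilinear_def
    by (safe intro!: linearI; simp add: cd_double_simps bil lin algebra_simps)
  show "linear (cd_cnj (cd_double A))"
    by (rule linearI) (auto simp: cd_double_simps lin)
qed

lemma bilinear_M0: "bilinear (cd_mult M0)" "linear (cd_cnj M0)"
  by (auto simp: bilinear_def M0_simps algebra_simps intro!: linearI)

lemmas bilinear_M1 = bilinear_cd_double[OF bilinear_M0, folded M1_def]
lemmas bilinear_M2 = bilinear_cd_double[OF bilinear_M1, folded M2_def]
lemmas bilinear_M3 = bilinear_cd_double[OF bilinear_M2, folded M3_def]
lemmas bilinear_M4 = bilinear_cd_double[OF bilinear_M3, folded M4_def]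

interpretation oct: bounded_bilinear "cd_mult M3"
  using bilinear_M3(1) by (simp add: bilinear_conv_bounded_bilinear)

lemma oct_e_tuples:
  "oct_e 0 = (((1, 0), (0, 0)), ((0, 0), (0, 0)))"
  "oct_e (Suc 0) = (((0, 1), (0, 0)), ((0, 0), (0, 0)))"
  "oct_e 2 = (((0, 0), (1, 0)), ((0, 0), (0, 0)))"
  "oct_e 3 = (((0, 0), (0, 1)), ((0, 0), (0, 0)))"
  "oct_e 4 = (((0, 0), (0, 0)), ((1, 0), (0, 0)))"
  "oct_e 5 = (((0, 0), (0, 0)), ((0, 1), (0, 0)))"
  "oct_e 6 = (((0, 0), (0, 0)), ((0, 0), (1, 0)))"
  "oct_e 7 = (((0, 0), (0, 0)), ((0, 0), (0, 1)))"
  by (simp_all add: M3_def M2_def M1_def M0_def cd_double_def zero_prod_def)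

section \<open>Octonion identities\<close>

lemma ocnj_ocnj [simp]: "ocnj (ocnj x) = x"
  by (cases x) (auto simp: cd_coords)

lemma ocnj_one [simp]: "ocnj oone = oone"
  by (simp add: cd_coords)

lemma ocnj_mult: "ocnj (x \<star> y) = ocnj y \<star> ocnj x"
  by (cases x; cases y) (auto simp: cd_coords algebra_simps)

lemma ocnj_conv: "ocnj x = (2 * (x \<bullet> oone)) *\<^sub>R oone - x"
  by (cases x) (auto simp: cd_coords)

text \<open>
  The identity on which the octonion theory rests: polarised and conjugated it yields the
  alternative laws and the doubling rule, and combined with \<open>oct_adjoint\<close> the
  multiplicativity of the norm.
\<close>
lemma oct_right_inverse: "(z \<star> x) \<star> ocnj x = (x \<bullet> x) *\<^sub>R z"
  by (cases x; cases z) (auto simp: cd_coords algebra_simps)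

lemma oct_adjoint: "(x \<star> y) \<bullet> z = x \<bullet> (z \<star> ocnj y)"
  by (cases x; cases y; cases z) (auto simp: cd_coords algebra_simps)

lemma ocnj_inner: "ocnj x \<bullet> ocnj y = x \<bullet> y"
  by (cases x; cases y) (auto simp: cd_coords)

lemmas linear_ocnj = bilinear_M3(2)
lemmas ocnj_linear = linear_add[OF linear_ocnj] linear_diff[OF linear_ocnj]
  linear_neg[OF linear_ocnj] linear_scale[OF linear_ocnj] linear_0[OF linear_ocnj]

lemmas oct_algebra = oct.add_left oct.add_right oct.diff_left oct.diff_right
  oct.minus_left oct.minus_right oct.scaleR_left oct.scaleR_right
  oct.zero_left oct.zero_right cd_one_M3

lemma oct_right_polar: "(z \<star> x) \<star> ocnj y + (z \<star> y) \<star> ocnj x = (2 * (x \<bullet> y)) *\<^sub>R z"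
  using oct_right_inverse[of z "x + y"] oct_right_inverse[of z x] oct_right_inverse[of z y]
  by (simp add: oct_algebra ocnj_linear inner_add_left inner_add_right inner_commute algebra_simps)

lemma oct_left_polar: "ocnj x \<star> (y \<star> z) + ocnj y \<star> (x \<star> z) = (2 * (x \<bullet> y)) *\<^sub>R z"
  using arg_cong[OF oct_right_polar[of "ocnj z" "ocnj x" "ocnj y"], of ocnj]
  by (simp add: ocnj_mult ocnj_linear ocnj_inner add.commute inner_commute)

lemma oct_left_inverse: "ocnj x \<star> (x \<star> z) = (x \<bullet> x) *\<^sub>R z"
  using arg_cong[OF oct_right_inverse[of "ocnj z" "ocnj x"], of ocnj]
  by (simp add: ocnj_mult ocnj_linear ocnj_inner)

lemma oct_norm_mult: "(x \<star> y) \<bullet> (x \<star> y) = (x \<bullet> x) * (y \<bullet> y)"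
  by (simp add: oct_adjoint oct_right_inverse)

lemma oone_unit: "oone \<bullet> oone = 1"
  by (simp add: cd_coords)

lemma ocnj_imag: "x \<bullet> oone = 0 \<Longrightarrow> ocnj x = - x"
  by (simp add: ocnj_conv)

section \<open>Automorphisms from basic triples\<close>

text \<open>
  Unital homomorphisms into the octonions that also respect conjugation. Respecting the
  conjugation is what allows such a map to be extended to the double of its domain.
\<close>
definition oct_hom :: "'a::real_vector cd_algebra \<Rightarrow> ('a \<Rightarrow> octonion) \<Rightarrow> bool" where
  "oct_hom A \<psi> \<longleftrightarrow> linear \<psi> \<and> \<psi> (cd_one A) = oone \<and>
     (\<forall>x. \<psi> (cd_cnj A x) = ocnj (\<psi> x)) \<and> (\<forall>x y. \<psi> (x \<odot>\<^bsub>A\<^esub> y) = \<psi> x \<star> \<psi> y)"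

text \<open>
  The Cayley-Dickson product is forced inside the octonions: if \<open>l\<close> is a unit orthogonal to
  a conjugation-closed subalgebra \<open>Q\<close>, then polarising \<open>(z x) x\<^bsup>*\<^esup> = n(x) z\<close> lets \<open>l\<close> be moved
  past the elements of \<open>Q\<close>, and this determines the product on \<open>Q + Q l\<close>. The result is
  the product of the double.
\<close>
lemma oct_hom_double:
  fixes A :: "'a::euclidean_space cd_algebra"
  assumes hom: "oct_hom A \<psi>" and orth: "\<And>x. \<psi> x \<bullet> l = 0" and unit: "l \<bullet> l = 1"
  shows "oct_hom (cd_double A) (\<lambda>(x, y). \<psi> x + \<psi> y \<star> l)"
proof -
  have lin: "linear \<psi>" and one: "\<psi> (cd_one A) = oone"
    and cnj: "\<And>x. \<psi> (cd_cnj A x) = ocnj (\<psi> x)"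
    and mult: "\<And>x y. \<psi> (x \<odot>\<^bsub>A\<^esub> y) = \<psi> x \<star> \<psi> y"
    using hom by (auto simp: oct_hom_def)
  note lins = linear_add[OF lin] linear_scale[OF lin] linear_diff[OF lin] linear_neg[OF lin]
    linear_0[OF lin]
  have l_imag: "ocnj l = - l"
    using orth[of "cd_one A"] by (simp add: one inner_commute ocnj_imag)
  have l_sq: "(x \<star> l) \<star> l = - x" for x
    using oct_right_inverse[of x l]
    by (simp add: l_imag unit oct_algebra minus_equation_iff[of _ x])
  have swap: "l \<star> ocnj (\<psi> x) = \<psi> x \<star> l" for x
    using oct_right_polar[of oone "\<psi> x" l] by (simp add: orth l_imag oct_algebra)
  have cnj_l: "ocnj (\<psi> x \<star> l) = - (\<psi> x \<star> l)" for x
    by (simp add: ocnj_mult l_imag swap oct_algebra)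
  have right: "(\<psi> y \<star> l) \<star> \<psi> z = (\<psi> y \<star> ocnj (\<psi> z)) \<star> l" for y z
    using oct_right_polar[of "\<psi> y" l "ocnj (\<psi> z)"] orth[of "cd_cnj A z"]
    by (simp add: l_imag oct_algebra cnj inner_commute)
  \<comment> \<open>The conjugate of \<open>w x\<close> is again a value of \<open>\<psi>\<close>, so \<open>swap\<close> applies to it.\<close>
  have left: "\<psi> x \<star> (\<psi> w \<star> l) = (\<psi> w \<star> \<psi> x) \<star> l" for x w
  proof -
    have "l \<star> (ocnj (\<psi> x) \<star> ocnj (\<psi> w)) = (\<psi> w \<star> \<psi> x) \<star> l"
      using swap[of "w \<odot>\<^bsub>A\<^esub> x"] by (simp add: mult ocnj_mult)
    then show ?thesis
      using oct_left_polar[of "ocnj (\<psi> x)" l "ocnj (\<psi> w)"] orth[of "cd_cnj A x"]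
      by (simp add: l_imag oct_algebra cnj swap)
  qed
  have both: "(\<psi> y \<star> l) \<star> (\<psi> w \<star> l) = - (ocnj (\<psi> w) \<star> \<psi> y)" for y w
  proof -
    have ip: "l \<bullet> (\<psi> w \<star> l) = \<psi> w \<bullet> oone"
      using oct_adjoint[of oone l "\<psi> w \<star> l"] oct_right_inverse[of "\<psi> w" l]
      by (simp add: unit oct_algebra inner_commute)
    have "(\<psi> y \<star> l) \<star> (\<psi> w \<star> l) = \<psi> w \<star> \<psi> y - (2 * (\<psi> w \<bullet> oone)) *\<^sub>R \<psi> y"
      using oct_right_polar[of "\<psi> y" l "- (\<psi> w \<star> l)"]
      by (simp add: ocnj_linear cnj_l l_imag left l_sq ip oct_algebra algebra_simps)
    then show ?thesis
      by (simp add: ocnj_conv[of "\<psi> w"] oct_algebra)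
  qed
  show ?thesis
    unfolding oct_hom_def
    by (auto intro!: linearI
        simp: cd_double_simps lins one cnj mult left right both swap cnj_l
          oct_algebra ocnj_linear algebra_simps)
qed

lemma oct_hom_M0: "oct_hom M0 (\<lambda>r. r *\<^sub>R oone)"
  by (auto simp: oct_hom_def M0_simps oct_algebra ocnj_linear algebra_simps intro!: linearI)

definition basic_triple :: "octonion \<Rightarrow> octonion \<Rightarrow> octonion \<Rightarrow> bool" where
  "basic_triple u v w \<longleftrightarrow> u \<bullet> u = 1 \<and> v \<bullet> v = 1 \<and> w \<bullet> w = 1 \<and>
     oone \<bullet> u = 0 \<and> oone \<bullet> v = 0 \<and> u \<bullet> v = 0 \<and>
     oone \<bullet> w = 0 \<and> u \<bullet> w = 0 \<and> v \<bullet> w = 0 \<and> (u \<star> v) \<bullet> w = 0"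

text \<open>
  Starting from the scalars, three doublings with the orthogonal units \<open>u\<close>, \<open>v\<close>, \<open>w\<close> rebuild
  the whole octonion algebra. This is the transitivity of \<open>G\<^sub>2\<close> on basic triples.
\<close>
lemma basic_triple_hom:
  assumes "basic_triple u v w"
  obtains \<phi> where "oct_hom M3 \<phi>" "\<phi> (oct_e 1) = u" "\<phi> (oct_e 2) = v" "\<phi> (oct_e 4) = w"
proof -
  define \<psi>1 where "\<psi>1 = (\<lambda>(x, y). x *\<^sub>R oone + (y *\<^sub>R oone) \<star> u)"
  define \<psi>2 where "\<psi>2 = (\<lambda>(x, y). \<psi>1 x + \<psi>1 y \<star> v)"
  define \<psi>3 where "\<psi>3 = (\<lambda>(x, y). \<psi>2 x + \<psi>2 y \<star> w)"
  note triple = assms[unfolded basic_triple_def]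
  have h1: "oct_hom M1 \<psi>1"
    unfolding \<psi>1_def using triple
    by (intro oct_hom_double[of M0, folded M1_def] oct_hom_M0) auto
  have h2: "oct_hom M2 \<psi>2"
    unfolding \<psi>2_def using triple
    by (intro oct_hom_double[of M1, folded M2_def] h1)
       (auto simp: \<psi>1_def oct_algebra inner_add_left)
  have h3: "oct_hom M3 \<psi>3"
    unfolding \<psi>3_def using triple
    by (intro oct_hom_double[of M2, folded M3_def] h2)
       (auto simp: \<psi>1_def \<psi>2_def oct_algebra inner_add_left)
  have "\<psi>3 (oct_e 1) = u" "\<psi>3 (oct_e 2) = v" "\<psi>3 (oct_e 4) = w"
    by (simp_all add: \<psi>3_def \<psi>2_def \<psi>1_def oct_e_tuples oct_algebra)
  with h3 show thesis by (rule that)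
qed

lemma oct_hom_id: "oct_hom M3 id"
  by (simp add: oct_hom_def linear_id del: split_paired_All)

text \<open>
  The sedenion product is built from the octonion product and conjugation alone, so an
  endomorphism of the octonions acts on pairs componentwise. It is injective because
  \<open>\<phi> x = 0\<close> makes \<open>\<phi>\<close> vanish on \<open>x x\<^bsup>*\<^esup>\<close>, a multiple of \<open>1\<close>.
\<close>
lemma oct_hom_aut:
  assumes "oct_hom M3 \<phi>" shows "map_prod \<phi> \<phi> \<in> cd_aut M4"
proof -
  have lin: "linear \<phi>" and one: "\<phi> oone = oone"
    and cnj: "\<And>x. \<phi> (ocnj x) = ocnj (\<phi> x)"
    and mult: "\<And>x y. \<phi> (x \<star> y) = \<phi> x \<star> \<phi> y"
    using assms by (auto simp: oct_hom_def)
  have "x = 0" if "\<phi> x = 0" for x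
    using mult[of x "ocnj x"] cd_norm_M3(1)[of x] that oone_unit
    by (auto simp: cnj one linear_scale[OF lin] oct_algebra cd_norm_def)
  then have "inj \<phi>"
    using lin by (simp add: linear_injective_0)
  then have "bij \<phi>"
    using lin by (simp add: bij_def linear_injective_imp_surjective)
  then have "bij (map_prod \<phi> \<phi>)"
    by (simp add: bij_betw_map_prod flip: UNIV_Times_UNIV)
  moreover have "linear (map_prod \<phi> \<phi>)"
    by (rule linearI)
       (simp_all add: prod_eq_iff linear_add[OF lin] linear_scale[OF lin])
  ultimately show ?thesis
    by (auto simp: cd_aut_def M4_simps mult cnj linear_add[OF lin] linear_diff[OF lin])
qed

section \<open>Anti-associative triples and zero products\<close>

definition oct_assoc :: "octonion \<Rightarrow> octonion \<Rightarrow> octonion \<Rightarrow> octonion" where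
  "oct_assoc x y z = (x \<star> y) \<star> z - x \<star> (y \<star> z)"

lemma norm_omult: "norm (x \<star> y) = norm x * norm y"
  by (simp add: norm_eq_sqrt_inner oct_norm_mult real_sqrt_mult)

lemma norm_oct_assoc_le: "norm (oct_assoc x y z) \<le> 2 * (norm x * norm y * norm z)"
  unfolding oct_assoc_def
  by (rule order_trans[OF norm_triangle_ineq4]) (simp add: norm_omult)

lemma oct_assoc_proj:
  "oct_assoc (x - r *\<^sub>R v) y z = oct_assoc x y z - r *\<^sub>R oct_assoc v y z"
  "oct_assoc x (y - r *\<^sub>R v) z = oct_assoc x y z - r *\<^sub>R oct_assoc x v z"
  "oct_assoc x y (z - r *\<^sub>R v) = oct_assoc x y z - r *\<^sub>R oct_assoc x y v"
  by (simp_all add: oct_assoc_def oct_algebra algebra_simps)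

lemma oct_left_alternative: "x \<star> (x \<star> z) = (x \<star> x) \<star> z"
proof -
  have "x \<star> y = (2 * (x \<bullet> oone)) *\<^sub>R y - ocnj x \<star> y" for y
    by (simp add: ocnj_conv oct_algebra)
  from this[of x] this[of "x \<star> z"] show ?thesis
    by (simp add: oct_left_inverse cd_norm_M3 oct_algebra)
qed

lemma oct_right_alternative: "(z \<star> x) \<star> x = z \<star> (x \<star> x)"
  using arg_cong[OF oct_left_alternative[of "ocnj x" "ocnj z"], of ocnj]
  by (simp add: ocnj_mult)

lemma oct_flexible: "(x \<star> y) \<star> x = x \<star> (y \<star> x)"
  using oct_left_alternative[of "x + y" x] oct_left_alternative[of x x]
    oct_left_alternative[of y x] oct_right_alternative[of y x]
  by (simp add: oct_algebra algebra_simps)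

lemma oct_assoc_eq_0:
  "oct_assoc oone y z = 0" "oct_assoc x oone z = 0" "oct_assoc x y oone = 0"
  "oct_assoc x x z = 0" "oct_assoc x z z = 0" "oct_assoc x y x = 0"
  "oct_assoc x (x \<star> z) z = 0"
  by (simp_all add: oct_assoc_def oct_algebra oct_left_alternative oct_right_alternative
      oct_flexible)

lemma unit_projection_gap:
  fixes y v :: "'a::real_inner"
  assumes "norm y = 1" "norm v = 1" "1 \<le> norm (y - (y \<bullet> v) *\<^sub>R v)"
  shows "y \<bullet> v = 0"
proof -
  have "(norm (y - (y \<bullet> v) *\<^sub>R v))\<^sup>2 = 1 - (y \<bullet> v)\<^sup>2"
    using assms(1,2) unfolding power2_norm_eq_inner
    by (simp add: inner_diff_left inner_diff_right inner_commute
        norm_eq_1 power2_eq_square)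
  moreover have "1 \<le> (norm (y - (y \<bullet> v) *\<^sub>R v))\<^sup>2"
    using assms(3) by simp
  ultimately have "(y \<bullet> v)\<^sup>2 \<le> 0" by linarith
  then show ?thesis by simp
qed

text \<open>
  For a triple of units with \<open>(x y) z = - x (y z)\<close> the associator has norm \<open>2\<close>, the largest
  value that three units allow. The associator does not change when one argument loses its
  component along a unit for which the associator vanishes, so that component must be \<open>0\<close>:
  otherwise the remaining argument would be shorter than \<open>1\<close>. The units used are \<open>1\<close>, the other
  arguments, and the product \<open>x z\<close>.
\<close>
lemma anti_associative_basic_triple:
  assumes anti: "(x \<star> y) \<star> z = - (x \<star> (y \<star> z))"
    and norms: "norm x = 1" "norm y = 1" "norm z = 1"
  shows "basic_triple x z y"
proof -
  \<comment> \<open>This attains the bound of \<open>norm_oct_assoc_le\<close> for units.\<close>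
  have norm_assoc: "norm (oct_assoc x y z) = 2"
  proof -
    have "oct_assoc x y z = - 2 *\<^sub>R (x \<star> (y \<star> z))"
      by (simp add: oct_assoc_def anti scaleR_2)
    then show ?thesis by (simp add: norm_omult norms)
  qed
  have x: "x \<bullet> v = 0" if "norm v = 1" "oct_assoc v y z = 0" for v
    using unit_projection_gap[OF norms(1) that(1)] norm_assoc that(2) norms
      norm_oct_assoc_le[of "x - (x \<bullet> v) *\<^sub>R v" y z]
    by (simp add: oct_assoc_proj)
  have y: "y \<bullet> v = 0" if "norm v = 1" "oct_assoc x v z = 0" for v
    using unit_projection_gap[OF norms(2) that(1)] norm_assoc that(2) norms
      norm_oct_assoc_le[of x "y - (y \<bullet> v) *\<^sub>R v" z]
    by (simp add: oct_assoc_proj)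
  have z: "z \<bullet> v = 0" if "norm v = 1" "oct_assoc x y v = 0" for v
    using unit_projection_gap[OF norms(3) that(1)] norm_assoc that(2) norms
      norm_oct_assoc_le[of x y "z - (z \<bullet> v) *\<^sub>R v"]
    by (simp add: oct_assoc_proj)
  have "norm oone = 1" "norm (x \<star> z) = 1"
    using oone_unit by (simp_all add: norm_eq_1 norm_omult norms)
  then show ?thesis
    using norms x[of oone] y[of oone] z[of oone] z[of x] y[of x] y[of z] y[of "x \<star> z"]
    by (simp add: basic_triple_def oct_assoc_eq_0 norm_eq_1 inner_commute)
qed

text \<open>
  Write \<open>c = e b\<close>. One component of the zero product gives \<open>d\<^bsup>*\<^esup> = - a e\<close>, and substituting
  this in the other leaves \<open>(a e) b = - a (e b)\<close>. Hence \<open>a\<close>, \<open>b\<close>, \<open>e\<close> form a basic triple,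
  and right multiplication by \<open>b\<close> carries the orthogonality relations from \<open>e\<close> to \<open>c\<close>.
\<close>
lemma zero_product_basic_triple:
  assumes zero: "(a, b) \<odot>\<^bsub>M4\<^esub> (c, d) = 0"
    and norms: "norm a = 1" "norm b = 1" "norm c = 1" "norm d = 1"
  shows "basic_triple a b c" and "d = (a \<star> c) \<star> b"
proof -
  note units = norms[unfolded norm_eq_1]
  define e where "e = c \<star> ocnj b"
  have c: "c = e \<star> b"
    using oct_right_inverse[of c "ocnj b"] by (simp add: e_def ocnj_inner units)
  have eqs: "a \<star> c = ocnj d \<star> b" "d \<star> a = - (b \<star> ocnj c)"
    using zero unfolding M4_simps by (simp_all add: prod_eq_iff eq_neg_iff_add_eq_0)
  have "d = - ((b \<star> ocnj c) \<star> ocnj a)"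
    using oct_right_inverse[of d a] by (simp add: eqs units oct_algebra)
  then have d: "ocnj d = - (a \<star> e)"
    by (simp add: ocnj_linear ocnj_mult e_def)
  have anti: "(a \<star> e) \<star> b = - (a \<star> (e \<star> b))"
    using eqs(1) by (simp add: d oct_algebra flip: c)
  have "norm e = 1"
    by (simp add: e_def norm_omult norms norm_eq_sqrt_inner[of "ocnj b"] ocnj_inner units)
  with anti norms have triple: "basic_triple a b e"
    by (intro anti_associative_basic_triple)
  then have imag: "ocnj a = - a" "ocnj b = - b" "ocnj e = - e"
    and orth: "a \<bullet> e = 0" "b \<bullet> e = 0" "(a \<star> b) \<bullet> e = 0"
    by (auto simp: basic_triple_def inner_commute intro!: ocnj_imag)
  have sq: "b \<star> b = - oone" "(a \<star> b) \<star> b = - a"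
    using oct_right_inverse[of oone b] oct_right_inverse[of a b]
    by (simp_all add: imag units oct_algebra minus_equation_iff[of _ a]
        minus_equation_iff[of _ oone])
  have "oone \<bullet> c = 0" "a \<bullet> c = 0" "b \<bullet> c = 0" "(a \<star> b) \<bullet> c = 0"
    using triple oct_adjoint[of e b oone] oct_adjoint[of e b a] oct_adjoint[of e b b]
      oct_adjoint[of e b "a \<star> b"]
    by (simp_all add: c basic_triple_def imag sq oct_algebra inner_commute)
  then show "basic_triple a b c"
    using triple units by (simp add: basic_triple_def)
  have "e \<star> a = - (a \<star> e)"
    using oct_right_polar[of oone a e] orth
    by (simp add: imag oct_algebra add_eq_0_iff)
  then have "d = a \<star> e"
    using arg_cong[OF d, of ocnj] by (simp add: ocnj_linear ocnj_mult imag oct_algebra)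
  then show "d = (a \<star> c) \<star> b"
    unfolding eqs(1) d
    using oct_right_inverse[of "a \<star> e" b] by (simp add: imag units oct_algebra)
qed

section \<open>Subalgebras with an explicit parametrisation\<close>

lemmas M4_linear = bilinear_ladd[OF bilinear_M4(1)] bilinear_radd[OF bilinear_M4(1)]
  bilinear_lmul[OF bilinear_M4(1)] bilinear_rmul[OF bilinear_M4(1)]

lemma span_three_range:
  "span {u, v, w} = range (\<lambda>(p, q, r). p *\<^sub>R u + q *\<^sub>R v + r *\<^sub>R w)"
  (is "?S = range ?f")
proof (intro equalityI subsetI)
  fix x assume "x \<in> ?S"
  then obtain p q r where "x - p *\<^sub>R u - q *\<^sub>R v - r *\<^sub>R w = 0"
    by (auto simp: span_breakdown_eq)
  then have "x = ?f (p, q, r)" by (simp add: algebra_simps)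
  then show "x \<in> range ?f" by blast
qed (auto intro!: span_add span_scale intro: span_base)

lemma span_four_range:
  "span {u, v, w, z} = range (\<lambda>((p, q), (r, s)). p *\<^sub>R u + q *\<^sub>R v + r *\<^sub>R w + s *\<^sub>R z)"
  (is "?S = range ?f")
proof (intro equalityI subsetI)
  fix x assume "x \<in> ?S"
  then obtain p q r s where "x - p *\<^sub>R u - q *\<^sub>R v - r *\<^sub>R w - s *\<^sub>R z = 0"
    by (auto simp: span_breakdown_eq)
  then have "x = ?f ((p, q), (r, s))" by (simp add: algebra_simps)
  then show "x \<in> range ?f" by blast
qed (auto intro!: span_add span_scale intro: span_base)

lemma linear_four: "linear (\<lambda>((p, q), (r, s)). p *\<^sub>R u + q *\<^sub>R v + r *\<^sub>R w + s *\<^sub>R z)"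
  by (rule linearI) (simp_all add: split_paired_all algebra_simps)

text \<open>
  Comparing dimensions replaces the inclusion \<open>W \<subseteq> span (set xs)\<close>, for which coefficients
  would have to be found.
\<close>
lemma span_orthogonal_list:
  fixes xs :: "'a::euclidean_space list"
  assumes "sorted_wrt orthogonal xs" "0 \<notin> set xs"
    and "set xs \<subseteq> W" "subspace W" "dim W = length xs"
  shows "span (set xs) = W"
proof -
  have "distinct xs \<and> pairwise orthogonal (set xs)"
    using assms(1,2)
    by (induction xs) (auto simp: pairwise_insert orthogonal_commute orthogonal_self)
  then have "dim (span (set xs)) = length xs"
    using pairwise_orthogonal_independent[of "set xs"] assms(2)
    by (simp add: dim_eq_card_independent distinct_card)
  then show ?thesis
    using assms(3-5) by (intro subspace_dim_equal subspace_span span_minimal) simp_all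
qed

lemma setcompr_range_two:
  "{f x y |x y. x \<in> range g \<and> y \<in> range g} = range (\<lambda>(v, w). f (g v) (g w))"
  by (force simp: image_iff)

lemma plus_translate_range:
  "plus_translate (range L) u = range (\<lambda>(v, w). L v + L w \<odot>\<^bsub>M4\<^esub> u)"
  unfolding plus_translate_def by (rule setcompr_range_two)

lemma plus_translate_span:
  "plus_translate (span B) u = span (B \<union> (\<lambda>x. x \<odot>\<^bsub>M4\<^esub> u) ` B)"
proof -
  have "linear (\<lambda>x. x \<odot>\<^bsub>M4\<^esub> u)"
    by (rule linearI) (simp_all only: M4_linear)
  then have image: "span ((\<lambda>x. x \<odot>\<^bsub>M4\<^esub> u) ` B) = (\<lambda>x. x \<odot>\<^bsub>M4\<^esub> u) ` span B"
    by (rule linear_span_image)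
  show ?thesis
    unfolding plus_translate_def span_Un image by blast
qed

lemma linear_plus_translate:
  assumes "linear L" shows "linear (\<lambda>(v, w). L v + L w \<odot>\<^bsub>M4\<^esub> u)"
  by (rule linearI)
     (auto simp: linear_add[OF assms] linear_scale[OF assms] M4_linear algebra_simps
       simp del: split_paired_All)

text \<open>
  A left inverse \<open>R\<close> that reads off parameters turns both injectivity of \<open>L\<close> and closure of its
  range under the product into equations between coordinates.
\<close>
lemma range_subalgebra:
  fixes L :: "'a::euclidean_space \<Rightarrow> sedenion"
  assumes lin: "linear L" and left_inverse: "\<And>v. R (L v) = v"
    and mult: "\<And>v w. L (R (L v \<odot>\<^bsub>M4\<^esub> L w)) = L v \<odot>\<^bsub>M4\<^esub> L w"
  shows "cd_subalgebra M4 (range L) \<and> dim (range L) = DIM('a)"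
proof
  have "L v \<odot>\<^bsub>M4\<^esub> L w \<in> range L" for v w
    using mult[of v w] by (metis rangeI)
  then show "cd_subalgebra M4 (range L)"
    unfolding cd_subalgebra_def
    using linear_subspace_image[OF lin subspace_UNIV] by blast
  have "inj L"
    using left_inverse by (rule inj_on_inverseI)
  then show "dim (range L) = DIM('a)"
    using dim_image_eq[OF lin, of UNIV] by simp
qed

section \<open>The reference subalgebras\<close>

definition S_3_param :: "real \<times> real \<times> real \<Rightarrow> sedenion" where
  "S_3_param = (\<lambda>(p, q, r). p *\<^sub>R (oct_e 0, 0) + q *\<^sub>R (oct_e 1, oct_e 4)
     + r *\<^sub>R (oct_e 2, oct_e 7))"

definition S_4_param :: "quaternion \<Rightarrow> sedenion" where
  "S_4_param = (\<lambda>((p, q), (r, s)). p *\<^sub>R (oct_e 0, 0) + q *\<^sub>R (oct_e 1, oct_e 2)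
     + r *\<^sub>R (oct_e 4, oct_e 7) + s *\<^sub>R (oct_e 5, - oct_e 6))"

definition sed_H_param :: "quaternion \<Rightarrow> sedenion" where
  "sed_H_param x = ((x, 0), 0)"

lemma param_coords:
  "S_3_param (p, q, r) =
     ((((p, q), (r, 0)), ((0, 0), (0, 0))), (((0, 0), (0, 0)), ((q, 0), (0, r))))"
  "S_4_param ((p, q), (r, s)) =
     ((((p, q), (0, 0)), ((r, s), (0, 0))), (((0, 0), (q, 0)), ((0, 0), (- s, r))))"
  "sed_H_param ((p, q), (r, s)) =
     ((((p, q), (r, s)), ((0, 0), (0, 0))), (((0, 0), (0, 0)), ((0, 0), (0, 0))))"
  by (simp_all add: S_3_param_def S_4_param_def sed_H_param_def oct_e_tuples zero_prod_def)

lemma linear_param: "linear S_3_param" "linear S_4_param" "linear sed_H_param"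
  by (rule linearI; simp add: split_paired_all param_coords algebra_simps)+

lemma sed_H_param_mult: "sed_H_param (x \<odot>\<^bsub>M2\<^esub> y) = sed_H_param x \<odot>\<^bsub>M4\<^esub> sed_H_param y"
proof -
  obtain p q r s p' q' r' s' where "x = ((p, q), (r, s))" "y = ((p', q'), (r', s'))"
    by (metis surj_pair)
  then show ?thesis by (simp add: param_coords cd_coords)
qed

lemma S_3_range: "S_3 = range S_3_param"
  unfolding S_3_def S_3_param_def cd_one_def by (rule span_three_range)

lemma S_4_range: "S_4 = range S_4_param"
  unfolding S_4_def S_4_param_def cd_one_def by (rule span_four_range)

lemma sed_H_range: "sed_H = range sed_H_param"
  by (simp add: sed_H_def sed_H_param_def[abs_def])

lemma S_3_algebra: "cd_subalgebra M4 S_3 \<and> dim S_3 = 3"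
proof -
  have "cd_subalgebra M4 (range S_3_param) \<and> dim (range S_3_param) = DIM(real \<times> real \<times> real)"
    by (intro range_subalgebra[where R = "\<lambda>((((a0, a1), (a2, a3)), ((a4, a5), (a6, a7))),
              (((b0, b1), (b2, b3)), ((b4, b5), (b6, b7)))).
            (a0, a1, a2)"]
          linear_plus_translate linear_param;
        simp add: split_paired_all param_coords cd_coords algebra_simps)
  then show ?thesis by (simp add: S_3_range)
qed

lemma S_4_algebra: "cd_subalgebra M4 S_4 \<and> dim S_4 = 4"
proof -
  have "cd_subalgebra M4 (range S_4_param) \<and> dim (range S_4_param) = DIM(quaternion)"
    by (intro range_subalgebra[where R = "\<lambda>((((a0, a1), (a2, a3)), ((a4, a5), (a6, a7))),
              (((b0, b1), (b2, b3)), ((b4, b5), (b6, b7)))).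
            ((a0, a1), (a4, a5))"]
          linear_plus_translate linear_param;
        simp add: split_paired_all param_coords cd_coords algebra_simps)
  then show ?thesis by (simp add: S_4_range)
qed

lemma S_6_algebra: "cd_subalgebra M4 S_6 \<and> dim S_6 = 6"
proof -
  let ?L = "\<lambda>(v, w). S_3_param v + S_3_param w \<odot>\<^bsub>M4\<^esub> (0, oone)"
  have "cd_subalgebra M4 (range ?L) \<and> dim (range ?L) =
      DIM((real \<times> real \<times> real) \<times> (real \<times> real \<times> real))"
    by (intro range_subalgebra[where R = "\<lambda>((((a0, a1), (a2, a3)), ((a4, a5), (a6, a7))),
              (((b0, b1), (b2, b3)), ((b4, b5), (b6, b7)))).
            ((a0, a1, a2), (b0, b1, b2))"]
          linear_plus_translate linear_param;
        simp add: split_paired_all param_coords cd_coords algebra_simps)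
  then show ?thesis by (simp add: S_6_def S_3_range plus_translate_range)
qed

lemma O_ije_algebra: "cd_subalgebra M4 O_ije \<and> dim O_ije = 8"
proof -
  let ?L = "\<lambda>(v, w). sed_H_param v + sed_H_param w \<odot>\<^bsub>M4\<^esub> (0, oone)"
  have "cd_subalgebra M4 (range ?L) \<and> dim (range ?L) = DIM(octonion)"
    by (intro range_subalgebra[where R = "\<lambda>((((a0, a1), (a2, a3)), ((a4, a5), (a6, a7))),
              (((b0, b1), (b2, b3)), ((b4, b5), (b6, b7)))).
            (((a0, a1), (a2, a3)), ((b0, b1), (b2, b3)))"]
          linear_plus_translate linear_param;
        simp add: split_paired_all param_coords cd_coords algebra_simps)
  then show ?thesis by (simp add: O_ije_def sed_H_range plus_translate_range)
qed

lemma S_8_algebra: "cd_subalgebra M4 S_8 \<and> dim S_8 = 8"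
proof -
  let ?L = "\<lambda>(v, w). sed_H_param v + sed_H_param w \<odot>\<^bsub>M4\<^esub> (0, oct_e 4)"
  have "cd_subalgebra M4 (range ?L) \<and> dim (range ?L) = DIM(octonion)"
    by (intro range_subalgebra[where R = "\<lambda>((((a0, a1), (a2, a3)), ((a4, a5), (a6, a7))),
              (((b0, b1), (b2, b3)), ((b4, b5), (b6, b7)))).
            (((a0, a1), (a2, a3)), ((b4, - b5), (- b6, - b7)))"]
          linear_plus_translate linear_param;
        simp add: split_paired_all param_coords oct_e_tuples cd_coords algebra_simps)
  then show ?thesis by (simp add: S_8_def sed_H_range plus_translate_range)
qed

lemma R_8_algebra: "cd_subalgebra M4 R_8 \<and> dim R_8 = 8"
proof -
  let ?L = "\<lambda>(v, w). S_4_param v + S_4_param w \<odot>\<^bsub>M4\<^esub> (0, oone)"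
  have "cd_subalgebra M4 (range ?L) \<and> dim (range ?L) = DIM(octonion)"
    by (intro range_subalgebra[where R = "\<lambda>((((a0, a1), (a2, a3)), ((a4, a5), (a6, a7))),
              (((b0, b1), (b2, b3)), ((b4, b5), (b6, b7)))).
            (((a0, a1), (a4, a5)), ((b0, b1), (b4, b5)))"]
          linear_plus_translate linear_param;
        simp add: split_paired_all param_coords cd_coords algebra_simps)
  then show ?thesis by (simp add: R_8_def S_4_range plus_translate_range)
qed

lemma S_6_span:
  "S_6 = span {(oct_e 0, 0), (oct_e 1, oct_e 4), (oct_e 2, oct_e 7),
     (0, oct_e 0), (- oct_e 4, oct_e 1), (- oct_e 7, oct_e 2)}"
proof -
  have three: "plus_translate (span {x, y, z}) u =
      span {x, y, z, x \<odot>\<^bsub>M4\<^esub> u, y \<odot>\<^bsub>M4\<^esub> u, z \<odot>\<^bsub>M4\<^esub> u}" for x y z u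
    unfolding plus_translate_span by (rule arg_cong[of _ _ span]) blast
  show ?thesis
    unfolding S_6_def S_3_def three by (simp add: cd_coords oct_e_tuples)
qed

lemma R_8_span:
  "R_8 = span {(oct_e 0, 0), (oct_e 1, oct_e 2), (oct_e 4, oct_e 7), (oct_e 5, - oct_e 6),
     (0, oct_e 0), (- oct_e 2, oct_e 1), (- oct_e 7, oct_e 4), (oct_e 6, oct_e 5)}"
proof -
  have four: "plus_translate (span {w, x, y, z}) u =
      span {w, x, y, z, w \<odot>\<^bsub>M4\<^esub> u, x \<odot>\<^bsub>M4\<^esub> u, y \<odot>\<^bsub>M4\<^esub> u, z \<odot>\<^bsub>M4\<^esub> u}" for w x y z u
    unfolding plus_translate_span by (rule arg_cong[of _ _ span]) blast
  show ?thesis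
    unfolding R_8_def S_4_def four by (simp add: cd_coords oct_e_tuples)
qed

lemma O_ije_mem: "((p, 0), (q, 0)) \<in> O_ije"
proof -
  obtain q0 q1 q2 q3 where q: "q = ((q0, q1), (q2, q3))" by (metis surj_pair)
  obtain p0 p1 p2 p3 where p: "p = ((p0, p1), (p2, p3))" by (metis surj_pair)
  show ?thesis
    unfolding O_ije_def sed_H_range plus_translate_range
    by (rule range_eqI[of _ _ "(p, q)"]) (simp add: p q param_coords cd_coords)
qed

lemma S_8_mem: "((p, 0), (0, q)) \<in> S_8"
proof -
  obtain q0 q1 q2 q3 where q: "q = ((q0, q1), (q2, q3))" by (metis surj_pair)
  obtain p0 p1 p2 p3 where p: "p = ((p0, p1), (p2, p3))" by (metis surj_pair)
  show ?thesis
    unfolding S_8_def sed_H_range plus_translate_range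
    \<comment> \<open>\<open>(y, 0) (0, e\<^sub>4) = (0, e\<^sub>4 y)\<close>, and \<open>e\<^sub>4 y = y\<^bsup>*\<^esup> e\<^sub>4\<close> for a quaternion \<open>y\<close>,
      so \<open>y\<close> is the conjugate of \<open>q\<close>.\<close>
    by (rule range_eqI[of _ _ "(p, ((q0, - q1), (- q2, - q3)))"])
       (simp add: p q param_coords cd_coords oct_e_tuples)
qed

section \<open>Conjugacy\<close>

lemma cd_conjugate_sym:
  fixes A :: "'a::euclidean_space cd_algebra"
  assumes "cd_conjugate A V W" shows "cd_conjugate A W V"
proof -
  obtain \<phi> where \<phi>: "bij \<phi>" "linear \<phi>" "\<And>x y. \<phi> (x \<odot>\<^bsub>A\<^esub> y) = \<phi> x \<odot>\<^bsub>A\<^esub> \<phi> y"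
    and image: "\<phi> ` V = W"
    using assms by (auto simp: cd_conjugate_def cd_aut_def)
  have "inv \<phi> (x \<odot>\<^bsub>A\<^esub> y) = inv \<phi> x \<odot>\<^bsub>A\<^esub> inv \<phi> y" for x y
    using \<phi>(1,3) by (metis bij_inv_eq_iff)
  moreover have "linear (inv \<phi>)"
    using \<phi> by (simp add: bij_is_inj inj_linear_imp_inv_linear)
  ultimately have "inv \<phi> \<in> cd_aut A"
    using \<phi>(1) by (auto simp: cd_aut_def bij_imp_bij_inv)
  moreover have "inv \<phi> ` W = V"
    using \<phi>(1) image by (metis bij_is_inj image_inv_f_f)
  ultimately show ?thesis
    unfolding cd_conjugate_def by blast
qed

lemma cd_conjugate_trans:
  assumes "cd_conjugate A U V" "cd_conjugate A V W" shows "cd_conjugate A U W"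
proof -
  obtain \<phi> \<psi> where *: "\<phi> \<in> cd_aut A" "\<phi> ` U = V" "\<psi> \<in> cd_aut A" "\<psi> ` V = W"
    using assms by (auto simp: cd_conjugate_def)
  then have "\<psi> \<circ> \<phi> \<in> cd_aut A"
    by (auto simp: cd_aut_def linear_compose bij_comp)
  then show ?thesis
    using * unfolding cd_conjugate_def by (metis image_comp)
qed

text \<open>
  Being a subalgebra and the dimension are invariant under conjugacy, so both need checking
  only for the reference subalgebras.
\<close>
lemma cd_conjugate_transfer:
  fixes A :: "'a::euclidean_space cd_algebra"
  assumes "cd_conjugate A V W" and sub: "cd_subalgebra A W"
  shows "cd_subalgebra A V \<and> dim V = dim W"
proof -
  obtain \<phi> where \<phi>: "bij \<phi>" "linear \<phi>" "\<And>x y. \<phi> (x \<odot>\<^bsub>A\<^esub> y) = \<phi> x \<odot>\<^bsub>A\<^esub> \<phi> y"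
    and image: "V = \<phi> ` W"
    using cd_conjugate_sym[OF assms(1)] by (auto simp: cd_conjugate_def cd_aut_def)
  have "cd_subalgebra A V"
    unfolding image cd_subalgebra_def
    using sub[unfolded cd_subalgebra_def] linear_subspace_image[OF \<phi>(2)]
    by (force simp flip: \<phi>(3))
  then show ?thesis
    using \<phi>(1,2) image dim_image_eq[of \<phi> W] by (auto simp: bij_def inj_on_def)
qed

lemma transported_conjugate:
  assumes "oct_hom M3 \<phi>" "oct_hom M3 \<sigma>" "map_prod \<sigma> \<sigma> ` U = W"
  shows "cd_conjugate M4 (map_prod \<phi> \<phi> ` U) W"
proof -
  have "cd_conjugate M4 U (map_prod \<phi> \<phi> ` U)" "cd_conjugate M4 U W"
    unfolding cd_conjugate_def using assms oct_hom_aut by blast+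
  then show ?thesis
    using cd_conjugate_sym cd_conjugate_trans by blast
qed

section \<open>The standard zero product\<close>

text \<open>
  For the basic triple \<open>e\<^sub>1\<close>, \<open>e\<^sub>2\<close>, \<open>e\<^sub>4\<close> the zero product is
  \<open>(e\<^sub>1, e\<^sub>2) (e\<^sub>4, - e\<^sub>7) = 0\<close>. The four maps below are automorphisms of the octonions that permute
  the basis up to sign. Applied to pairs they fix \<open>(1, 0)\<close> and \<open>(0, 1)\<close>, send
  \<open>f\<^sub>1 = (e\<^sub>1, e\<^sub>2)\<close> to \<open>(e\<^sub>1, e\<^sub>4)\<close>, and send the element that each is named after to
  \<open>(e\<^sub>2, e\<^sub>7)\<close>; these are the generators of \<open>S_3\<close>. They are the inverses of the
  automorphisms that take \<open>e\<^sub>1\<close>, \<open>e\<^sub>2\<close>, \<open>e\<^sub>4\<close> to \<open>e\<^sub>1\<close>, \<open>v\<close>, \<open>e\<^sub>2\<close>, where \<open>v\<close> is the first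
  component of that element.
\<close>
definition std_f4 :: "octonion \<Rightarrow> octonion" where
  "std_f4 = (\<lambda>(((x0, x1), (x2, x3)), ((x4, x5), (x6, x7))).
     (((x0, x1), (x5, - x4)), ((x2, x3), (- x7, x6))))"

definition std_f5 :: "octonion \<Rightarrow> octonion" where
  "std_f5 = (\<lambda>(((x0, x1), (x2, x3)), ((x4, x5), (x6, x7))).
     (((x0, x1), (x4, x5)), ((x2, x3), (- x6, - x7))))"

definition std_tf4 :: "octonion \<Rightarrow> octonion" where
  "std_tf4 = (\<lambda>(((x0, x1), (x2, x3)), ((x4, x5), (x6, x7))).
     (((x0, x1), (- x6, x7)), ((x2, x3), (- x4, x5))))"

definition std_tf5 :: "octonion \<Rightarrow> octonion" where
  "std_tf5 = (\<lambda>(((x0, x1), (x2, x3)), ((x4, x5), (x6, x7))).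
     (((x0, x1), (x7, x6)), ((x2, x3), (x5, x4))))"

lemmas std_defs = std_f4_def std_f5_def std_tf4_def std_tf5_def

lemma oct_hom_std: "oct_hom M3 std_f4" "oct_hom M3 std_f5" "oct_hom M3 std_tf4" "oct_hom M3 std_tf5"
  by (simp_all add: oct_hom_def linear_iff std_defs split_paired_all cd_coords
      algebra_simps)

lemma oct_hom_image_span:
  assumes "oct_hom M3 \<sigma>"
  shows "map_prod \<sigma> \<sigma> ` span B = span (map_prod \<sigma> \<sigma> ` B)"
  using oct_hom_aut[OF assms] by (simp add: cd_aut_def linear_span_image)

lemma std_span_S_3:
  "map_prod std_f4 std_f4 ` span {(oct_e 0, 0), (oct_e 1, oct_e 2), (oct_e 5, oct_e 6)} = S_3"
  "map_prod std_f5 std_f5 ` span {(oct_e 0, 0), (oct_e 1, oct_e 2), (oct_e 4, - oct_e 7)} = S_3"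
  "map_prod std_tf4 std_tf4 ` span {(oct_e 0, 0), (oct_e 1, oct_e 2), (- oct_e 6, oct_e 5)} = S_3"
  "map_prod std_tf5 std_tf5 ` span {(oct_e 0, 0), (oct_e 1, oct_e 2), (oct_e 7, oct_e 4)} = S_3"
  unfolding S_3_def oct_hom_image_span[OF oct_hom_std(1)] oct_hom_image_span[OF oct_hom_std(2)]
    oct_hom_image_span[OF oct_hom_std(3)] oct_hom_image_span[OF oct_hom_std(4)]
  by (simp_all add: std_defs oct_e_tuples cd_coords)

lemma std_span_S_6:
  "map_prod std_f4 std_f4 ` span {(oct_e 0, 0), (oct_e 1, oct_e 2), (oct_e 5, oct_e 6),
     (0, oct_e 0), (- oct_e 2, oct_e 1), (- oct_e 6, oct_e 5)} = S_6"
  "map_prod std_f5 std_f5 ` span {(oct_e 0, 0), (oct_e 1, oct_e 2), (oct_e 4, - oct_e 7),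
     (0, oct_e 0), (- oct_e 2, oct_e 1), (oct_e 7, oct_e 4)} = S_6"
  unfolding S_6_span oct_hom_image_span[OF oct_hom_std(1)] oct_hom_image_span[OF oct_hom_std(2)]
  by (simp_all add: std_defs oct_e_tuples cd_coords)

text \<open>
  Sums and differences of the generators show that the span consists of the pairs with first
  component in \<open>Q = Lin(1, e\<^sub>1, e\<^sub>4, e\<^sub>5)\<close> and second component orthogonal to \<open>Q\<close>. The
  automorphism takes \<open>Q\<close> to the standard quaternions, and hence the span to \<open>S_8\<close>, which is
  built from them in the same way.
\<close>
lemma std_f5_span_S_8:
  "map_prod std_f5 std_f5 ` span
     {(oct_e 0, 0), (oct_e 1, oct_e 2), (oct_e 4, oct_e 7), (oct_e 5, - oct_e 6),
     (oct_e 5, oct_e 6), (oct_e 4, - oct_e 7), (oct_e 1, - oct_e 2),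
     (0, oct_e 3)} = S_8"
proof -
  have S_8: "subspace S_8" "dim S_8 = 8"
    using S_8_algebra by (simp_all add: cd_subalgebra_def)
  have "span (set (map (map_prod std_f5 std_f5)
     [(oct_e 0, 0), (oct_e 1, oct_e 2), (oct_e 4, oct_e 7), (oct_e 5, - oct_e 6),
     (oct_e 5, oct_e 6), (oct_e 4, - oct_e 7), (oct_e 1, - oct_e 2), (0, oct_e 3)])) = S_8"
    by (rule span_orthogonal_list)
       (simp_all add: orthogonal_def std_defs oct_e_tuples S_8
          S_8_mem[unfolded zero_prod_def] zero_prod_def)
  then show ?thesis
    unfolding oct_hom_image_span[OF oct_hom_std(2)]
    by (simp only: list.map set_simps image_insert image_empty)
qed

text \<open>
  The same with the quaternion algebra \<open>Lin(1, e\<^sub>1, e\<^sub>6, e\<^sub>7)\<close>.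
\<close>
lemma std_tf4_span_S_8:
  "map_prod std_tf4 std_tf4 ` span
     {(oct_e 0, 0), (oct_e 1, oct_e 2), (oct_e 1, - oct_e 2), (0, oct_e 3),
     (- oct_e 7, oct_e 4), (oct_e 6, oct_e 5), (- oct_e 6, oct_e 5), (oct_e 7, oct_e 4)} = S_8"
proof -
  have S_8: "subspace S_8" "dim S_8 = 8"
    using S_8_algebra by (simp_all add: cd_subalgebra_def)
  have "span (set (map (map_prod std_tf4 std_tf4)
     [(oct_e 0, 0), (oct_e 1, oct_e 2), (oct_e 1, - oct_e 2), (0, oct_e 3),
     (- oct_e 7, oct_e 4), (oct_e 6, oct_e 5), (- oct_e 6, oct_e 5), (oct_e 7, oct_e 4)])) = S_8"
    by (rule span_orthogonal_list)
       (simp_all add: orthogonal_def std_defs oct_e_tuples S_8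
          S_8_mem[unfolded zero_prod_def] zero_prod_def)
  then show ?thesis
    unfolding oct_hom_image_span[OF oct_hom_std(3)]
    by (simp only: list.map set_simps image_insert image_empty)
qed

lemma span_O_ije:
  "span {(oct_e 0, 0), (oct_e 1, oct_e 2), (oct_e 1, - oct_e 2), (0, oct_e 3),
     (0, oct_e 0), (- oct_e 2, oct_e 1), (oct_e 2, oct_e 1), (- oct_e 3, 0)} = O_ije"
proof -
  have O: "subspace O_ije" "dim O_ije = 8"
    using O_ije_algebra by (simp_all add: cd_subalgebra_def)
  note mem = O_ije_mem[of "((p0, p1), (p2, p3))" "((q0, q1), (q2, q3))" for p0 p1 p2 p3 q0 q1 q2 q3]
  have "span (set [(oct_e 0, 0), (oct_e 1, oct_e 2), (oct_e 1, - oct_e 2), (0, oct_e 3),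
     (0, oct_e 0), (- oct_e 2, oct_e 1), (oct_e 2, oct_e 1), (- oct_e 3, 0)]) = O_ije"
    by (rule span_orthogonal_list)
       (simp_all add: orthogonal_def oct_e_tuples O zero_prod_def mem[unfolded zero_prod_def])
  then show ?thesis by simp
qed

section \<open>Quaternion subalgebras\<close>

definition quaternionic :: "sedenion set \<Rightarrow> bool" where
  "quaternionic V \<longleftrightarrow> (\<exists>\<psi>. linear \<psi> \<and> inj \<psi> \<and>
     (\<forall>x y. \<psi> (x \<odot>\<^bsub>M2\<^esub> y) = \<psi> x \<odot>\<^bsub>M4\<^esub> \<psi> y) \<and> V = range \<psi>)"

lemma quaternionic_aut:
  assumes "quaternionic V" "\<phi> \<in> cd_aut M4" shows "quaternionic (\<phi> ` V)"
proof -
  obtain \<psi> where *: "linear \<psi>" "inj \<psi>" "\<forall>x y. \<psi> (x \<odot>\<^bsub>M2\<^esub> y) = \<psi> x \<odot>\<^bsub>M4\<^esub> \<psi> y" "V = range \<psi>"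
    using assms(1) unfolding quaternionic_def by blast
  have "linear (\<phi> \<circ> \<psi>)" "inj (\<phi> \<circ> \<psi>)" "\<phi> ` V = range (\<phi> \<circ> \<psi>)"
    using * assms(2) by (auto simp: cd_aut_def linear_compose inj_compose bij_is_inj)
  moreover have "\<forall>x y. (\<phi> \<circ> \<psi>) (x \<odot>\<^bsub>M2\<^esub> y) = (\<phi> \<circ> \<psi>) x \<odot>\<^bsub>M4\<^esub> (\<phi> \<circ> \<psi>) y"
    using *(3) assms(2) by (simp add: cd_aut_def del: split_paired_All)
  ultimately show ?thesis
    unfolding quaternionic_def by blast
qed

lemma quaternionic_iso:
  assumes "quaternionic V"
  shows "cd_subalgebra M4 V \<and> dim V = 4 \<and> cd_isomorphic M4 V sed_H"
proof -
  obtain \<psi> where lin: "linear \<psi>" and inj: "inj \<psi>"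
    and mult: "\<And>x y. \<psi> (x \<odot>\<^bsub>M2\<^esub> y) = \<psi> x \<odot>\<^bsub>M4\<^esub> \<psi> y" and V: "V = range \<psi>"
    using assms unfolding quaternionic_def by blast
  have sub: "cd_subalgebra M4 V"
    unfolding V cd_subalgebra_def
  proof (intro conjI ballI)
    show "subspace (range \<psi>)"
      using linear_subspace_image[OF lin subspace_UNIV] .
    fix x y assume "x \<in> range \<psi>" "y \<in> range \<psi>"
    then obtain u v where "x = \<psi> u" "y = \<psi> v" by (elim rangeE)
    then have "x \<odot>\<^bsub>M4\<^esub> y = \<psi> (u \<odot>\<^bsub>M2\<^esub> v)" by (simp only: mult)
    then show "x \<odot>\<^bsub>M4\<^esub> y \<in> range \<psi>" by (rule range_eqI)
  qed
  have dim: "dim V = 4"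
    using dim_image_eq[OF lin, of UNIV] inj by (simp add: V)
  define \<phi> where "\<phi> = sed_H_param \<circ> inv \<psi>"
  have \<phi>: "\<phi> (\<psi> x) = sed_H_param x" for x
    using inj by (simp add: \<phi>_def)
  have "inj_on \<phi> (range \<psi>)"
  proof (rule inj_onI)
    fix x y assume "x \<in> range \<psi>" "y \<in> range \<psi>" and eq: "\<phi> x = \<phi> y"
    then obtain u v where "x = \<psi> u" "y = \<psi> v" by (elim rangeE)
    with eq show "x = y" by (simp add: \<phi> sed_H_param_def)
  qed
  then have "bij_betw \<phi> V sed_H"
    unfolding V sed_H_range bij_betw_def image_image by (simp only: \<phi> simp_thms)
  moreover have "sed_H_param (x \<odot>\<^bsub>M2\<^esub> y) = sed_H_param x \<odot>\<^bsub>M4\<^esub> sed_H_param y" for x y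
    by (rule sed_H_param_mult)
  ultimately have "cd_isomorphic M4 V sed_H"
    unfolding cd_isomorphic_def V
    by (intro exI[of _ \<phi>] conjI allI ballI; (elim rangeE)?;
        simp only: \<phi> flip: mult linear_add[OF lin] linear_scale[OF lin]
          linear_add[OF linear_param(3)] linear_scale[OF linear_param(3)])
  with sub dim show ?thesis by simp
qed

text \<open>
  The sedenions are not alternative, so the relations between \<open>i\<close>, \<open>j\<close>, \<open>k\<close> do not follow from a
  few of them: the whole multiplication table is required. Linear independence does follow,
  since a homomorphism that kills \<open>x\<close> also kills \<open>x x\<^bsup>*\<^esup>\<close>.
\<close>
lemma quaternionic_span:
  fixes i j k :: sedenion
  assumes "i \<odot>\<^bsub>M4\<^esub> i = - (oone, 0)" "j \<odot>\<^bsub>M4\<^esub> j = - (oone, 0)" "k \<odot>\<^bsub>M4\<^esub> k = - (oone, 0)"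
    and "i \<odot>\<^bsub>M4\<^esub> j = k" "j \<odot>\<^bsub>M4\<^esub> k = i" "k \<odot>\<^bsub>M4\<^esub> i = j"
    and "j \<odot>\<^bsub>M4\<^esub> i = - k" "k \<odot>\<^bsub>M4\<^esub> j = - i" "i \<odot>\<^bsub>M4\<^esub> k = - j"
  shows "quaternionic (span {(oone, 0), i, j, k})"
proof -
  let ?one = "(oone, 0) :: sedenion"
  define \<psi> where "\<psi> = (\<lambda>((p, q), (r, s)). p *\<^sub>R ?one + q *\<^sub>R i + r *\<^sub>R j + s *\<^sub>R k)"
  have lin: "linear \<psi>"
    unfolding \<psi>_def by (rule linear_four)
  have mult: "\<psi> (x \<odot>\<^bsub>M2\<^esub> y) = \<psi> x \<odot>\<^bsub>M4\<^esub> \<psi> y" for x y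
  proof -
    obtain p q r s p' q' r' s' where "x = ((p, q), (r, s))" "y = ((p', q'), (r', s'))"
      by (metis surj_pair)
    then show ?thesis
      by (simp add: \<psi>_def M2_simps M1_simps M0_simps M4_linear cd_one_M4 assms
          algebra_simps del: scaleR_Pair uminus_Pair)
  qed
  have "x = 0" if "\<psi> x = 0" for x
  proof -
    obtain p q r s where x: "x = ((p, q), (r, s))" by (metis surj_pair)
    have "\<psi> (x \<odot>\<^bsub>M2\<^esub> cd_cnj M2 x) = (p * p + q * q + r * r + s * s) *\<^sub>R ?one"
      by (simp add: x \<psi>_def M2_simps M1_simps M0_simps algebra_simps)
    then have "(p * p + q * q + r * r + s * s) *\<^sub>R ?one = 0"
      by (simp only: mult that bilinear_lzero[OF bilinear_M4(1)])
    moreover have "?one \<noteq> 0" by (simp add: cd_coords)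
    ultimately have "p * p + q * q + r * r + s * s = 0"
      by (simp only: scaleR_eq_0_iff simp_thms)
    then show ?thesis
      by (simp add: x add_nonneg_eq_0_iff zero_prod_def)
  qed
  then have "inj \<psi>" using lin by (simp add: linear_injective_0)
  moreover have "span {?one, i, j, k} = range \<psi>"
    unfolding \<psi>_def by (rule span_four_range)
  ultimately show ?thesis
    using lin mult unfolding quaternionic_def by blast
qed

text \<open>
  The units are \<open>(e\<^sub>1, 0)\<close> and \<open>(0, e\<^sub>2)\<close>, half the sum and half the difference of
  \<open>f\<^sub>1\<close> and \<open>f\<^sub>6\<close>, and their product.
\<close>
lemma quaternionic_f6:
  "quaternionic (span {(oct_e 0, 0), (oct_e 1, oct_e 2), (oct_e 1, - oct_e 2), (0, oct_e 3)})"
proof -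
  let ?V = "span {(oone, 0), (oct_e 1, 0), (0, oct_e 2), (0, - oct_e 3)} :: sedenion set"
  have V: "quaternionic ?V"
    by (rule quaternionic_span) (simp_all add: cd_coords oct_e_tuples)
  have "span (set [(oct_e 0, 0), (oct_e 1, oct_e 2), (oct_e 1, - oct_e 2), (0, oct_e 3)]) = ?V"
  proof (rule span_orthogonal_list)
    have "(oct_e 1, oct_e 2) = (oct_e 1, 0) + (0, oct_e 2)"
      "(oct_e 1, - oct_e 2) = (oct_e 1, 0) - (0, oct_e 2)"
      "(0, oct_e 3) = - (0 :: octonion, - oct_e 3)"
      by simp_all
    then show "set [(oct_e 0, 0), (oct_e 1, oct_e 2), (oct_e 1, - oct_e 2), (0, oct_e 3)] \<subseteq> ?V"
      by (auto simp only: list.set insert_subset empty_subsetI simp_thms cd_one_def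
          intro!: span_add span_diff span_neg intro: span_base)
  qed (use quaternionic_iso[OF V] in \<open>simp_all add: orthogonal_def oct_e_tuples zero_prod_def\<close>)
  with V show ?thesis by (simp only: list.set)
qed

text \<open>
  Since \<open>(e\<^sub>1, e\<^sub>2)\<close> has square \<open>- 2\<close>, imaginary units are obtained after division
  by \<open>sqrt 2\<close>.
\<close>
lemma quaternionic_tf0:
  "quaternionic (span {(oct_e 0, 0), (oct_e 1, oct_e 2), (0, oct_e 0), (- oct_e 2, oct_e 1)})"
proof -
  let ?i = "(1 / sqrt 2) *\<^sub>R (oct_e 1, oct_e 2)" and ?k = "(1 / sqrt 2) *\<^sub>R (- oct_e 2, oct_e 1)"
  let ?V = "span {(oone, 0), ?i, (0, oct_e 0), ?k} :: sedenion set"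
  have V: "quaternionic ?V"
    by (rule quaternionic_span) (simp_all add: cd_coords oct_e_tuples)
  have "span (set [(oct_e 0, 0), (oct_e 1, oct_e 2), (0, oct_e 0), (- oct_e 2, oct_e 1)]) = ?V"
  proof (rule span_orthogonal_list)
    have "sqrt 2 *\<^sub>R ?i \<in> ?V" "sqrt 2 *\<^sub>R ?k \<in> ?V"
      by (blast intro: span_scale span_base)+
    then show "set [(oct_e 0, 0), (oct_e 1, oct_e 2), (0, oct_e 0), (- oct_e 2, oct_e 1)] \<subseteq> ?V"
      by (simp add: span_base flip: cd_one_def)
  qed (use quaternionic_iso[OF V] in \<open>simp_all add: orthogonal_def oct_e_tuples zero_prod_def\<close>)
  with V show ?thesis by (simp only: list.set)
qed

lemma quaternionic_tf6:
  "quaternionic (span {(oct_e 0, 0), (oct_e 1, oct_e 2), (oct_e 2, oct_e 1), (- oct_e 3, 0)})"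
proof -
  let ?i = "(1 / sqrt 2) *\<^sub>R (oct_e 1, oct_e 2)" and ?j = "(1 / sqrt 2) *\<^sub>R (oct_e 2, oct_e 1)"
  let ?V = "span {(oone, 0), ?i, ?j, (oct_e 3, 0)} :: sedenion set"
  have V: "quaternionic ?V"
    by (rule quaternionic_span) (simp_all add: cd_coords oct_e_tuples)
  have "span (set [(oct_e 0, 0), (oct_e 1, oct_e 2), (oct_e 2, oct_e 1), (- oct_e 3, 0)]) = ?V"
  proof (rule span_orthogonal_list)
    have "sqrt 2 *\<^sub>R ?i \<in> ?V" "sqrt 2 *\<^sub>R ?j \<in> ?V" "- (oct_e 3, 0) \<in> ?V"
      by (blast intro: span_scale span_base span_neg)+
    then show "set [(oct_e 0, 0), (oct_e 1, oct_e 2), (oct_e 2, oct_e 1), (- oct_e 3, 0)] \<subseteq> ?V"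
      by (simp add: span_base flip: cd_one_def)
  qed (use quaternionic_iso[OF V] in \<open>simp_all add: orthogonal_def oct_e_tuples zero_prod_def\<close>)
  with V show ?thesis by (simp only: list.set)
qed

section \<open>The subalgebras containing a zero divisor\<close>

theorem proposition5p4:
  fixes a b c d :: octonion
    and f0 f1 f2 f3 f4 f5 f6 f7 :: sedenion
    and tf0 tf1 tf2 tf3 tf4 tf5 tf6 tf7 :: sedenion
  assumes "(a, b) \<in> zero_divisors M4" and "(c, d) \<in> zero_divisors M4"
    and "(a, b) \<odot>\<^bsub>M4\<^esub> (c, d) = 0"
    and "cd_norm M3 a = cd_one M3" and "cd_norm M3 b = cd_one M3"
    and "cd_norm M3 c = cd_one M3" and "cd_norm M3 d = cd_one M3"
    and "f0 = (cd_one M3, 0)"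
    and "f1 = (a, b)"
    and "f2 = (c, - d)"
    and "f3 = (a \<odot>\<^bsub>M3\<^esub> c, a \<odot>\<^bsub>M3\<^esub> d)"
    and "f4 = (a \<odot>\<^bsub>M3\<^esub> c, - (a \<odot>\<^bsub>M3\<^esub> d))"
    and "f5 = (c, d)"
    and "f6 = (a, - b)"
    and "f7 = (0, a \<odot>\<^bsub>M3\<^esub> b)"
    and "tf0 = (0, cd_one M3)"
    and "tf1 = (- b, a)"
    and "tf2 = (d, c)"
    and "tf3 = (- (a \<odot>\<^bsub>M3\<^esub> d), a \<odot>\<^bsub>M3\<^esub> c)"
    and "tf4 = (a \<odot>\<^bsub>M3\<^esub> d, a \<odot>\<^bsub>M3\<^esub> c)"
    and "tf5 = (- d, c)"
    and "tf6 = (b, a)"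
    and "tf7 = (- (a \<odot>\<^bsub>M3\<^esub> b), 0)"
  shows
    "(\<forall>V \<in> {span {f0, f1, f4}, span {f0, f1, f5}, span {f0, f1, tf4}, span {f0, f1, tf5}}.
        cd_subalgebra M4 V \<and> f1 \<in> V \<and> dim V = 3 \<and> V \<sim>\<^sub>S S_3) \<and>
     (\<forall>V \<in> {span {f0, f1, f6, f7}, span {f0, f1, tf0, tf1}, span {f0, f1, tf6, tf7}}.
        cd_subalgebra M4 V \<and> f1 \<in> V \<and> dim V = 4 \<and> V \<cong>\<^sub>S sed_H) \<and>
     (\<forall>V \<in> {span {f0, f1, f2, f3}}.
        cd_subalgebra M4 V \<and> f1 \<in> V \<and> dim V = 4 \<and> V \<sim>\<^sub>S S_4) \<and>
     (\<forall>V \<in> {span {f0, f1, f4, tf0, tf1, tf4}, span {f0, f1, f5, tf0, tf1, tf5}}.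
        cd_subalgebra M4 V \<and> f1 \<in> V \<and> dim V = 6 \<and> V \<sim>\<^sub>S S_6) \<and>
     (\<forall>V \<in> {span {f0, f1, f2, f3, f4, f5, f6, f7},
            span {f0, f1, f6, f7, tf2, tf3, tf4, tf5}}.
        cd_subalgebra M4 V \<and> f1 \<in> V \<and> dim V = 8 \<and> V \<sim>\<^sub>S S_8) \<and>
     (\<forall>V \<in> {span {f0, f1, f6, f7, tf0, tf1, tf6, tf7}}.
        cd_subalgebra M4 V \<and> f1 \<in> V \<and> dim V = 8 \<and> V \<sim>\<^sub>S O_ije) \<and>
     (\<forall>V \<in> {span {f0, f1, f2, f3, tf0, tf1, tf2, tf3}}.
        cd_subalgebra M4 V \<and> f1 \<in> V \<and> dim V = 8 \<and> V \<sim>\<^sub>S R_8)"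
proof -
  have "x \<bullet> x = 1" if "cd_norm M3 x = oone" for x :: octonion
    using arg_cong[OF that, of "\<lambda>y. y \<bullet> oone"] by (simp add: cd_norm_M3 oone_unit)
  then have norms: "norm a = 1" "norm b = 1" "norm c = 1" "norm d = 1"
    using assms(4-7) by (simp_all add: norm_eq_1)
  from zero_product_basic_triple[OF assms(3) norms]
  have triple: "basic_triple a b c" and d: "d = (a \<star> c) \<star> b" by blast+
  obtain \<phi> where hom: "oct_hom M3 \<phi>"
    and \<phi>: "\<phi> (oct_e 1) = a" "\<phi> (oct_e 2) = b" "\<phi> (oct_e 4) = c"
    using basic_triple_hom[OF triple] .
  have lin: "linear \<phi>" and one: "\<phi> (oct_e 0) = oone"
    and mult: "\<And>x y. \<phi> (x \<star> y) = \<phi> x \<star> \<phi> y"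
    using hom by (auto simp: oct_hom_def cd_one_def)
  have table: "oct_e 1 \<star> oct_e 4 = oct_e 5" "oct_e 5 \<star> oct_e 2 = - oct_e 7"
    "oct_e 1 \<star> oct_e 7 = oct_e 6" "oct_e 1 \<star> oct_e 2 = oct_e 3"
    by (simp_all add: cd_coords oct_e_tuples)
  \<comment> \<open>All the elements are images under \<open>\<phi>\<close> of those for \<open>a = e\<^sub>1\<close>, \<open>b = e\<^sub>2\<close>, \<open>c = e\<^sub>4\<close>.\<close>
  have ac: "a \<star> c = \<phi> (oct_e 5)"
    by (simp only: table(1) flip: \<phi> mult)
  have d7: "d = - \<phi> (oct_e 7)"
    unfolding d ac by (simp only: table(2) linear_neg[OF lin] flip: \<phi> mult)
  have ad: "a \<star> d = - \<phi> (oct_e 6)"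
    unfolding d7 by (simp only: table(3) oct.minus_right flip: \<phi> mult)
  have ab: "a \<star> b = \<phi> (oct_e 3)"
    by (simp only: table(4) flip: \<phi> mult)
  let ?\<Phi> = "map_prod \<phi> \<phi>"
  note aut = oct_hom_aut[OF hom]
  have span: "span (?\<Phi> ` B) = ?\<Phi> ` span B" for B
    using aut by (simp add: cd_aut_def linear_span_image)
  have F: "f0 = ?\<Phi> (oct_e 0, 0)" "f1 = ?\<Phi> (oct_e 1, oct_e 2)" "f2 = ?\<Phi> (oct_e 4, oct_e 7)"
    "f3 = ?\<Phi> (oct_e 5, - oct_e 6)" "f4 = ?\<Phi> (oct_e 5, oct_e 6)"
    "f5 = ?\<Phi> (oct_e 4, - oct_e 7)" "f6 = ?\<Phi> (oct_e 1, - oct_e 2)" "f7 = ?\<Phi> (0, oct_e 3)"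
    "tf0 = ?\<Phi> (0, oct_e 0)" "tf1 = ?\<Phi> (- oct_e 2, oct_e 1)" "tf2 = ?\<Phi> (- oct_e 7, oct_e 4)"
    "tf3 = ?\<Phi> (oct_e 6, oct_e 5)" "tf4 = ?\<Phi> (- oct_e 6, oct_e 5)"
    "tf5 = ?\<Phi> (oct_e 7, oct_e 4)" "tf6 = ?\<Phi> (oct_e 2, oct_e 1)" "tf7 = ?\<Phi> (- oct_e 3, 0)"
    unfolding assms(8-23) ac ad ab unfolding d7
    by (simp_all only: map_prod_simp linear_0[OF lin] linear_neg[OF lin] one \<phi> minus_minus)
  have copy: "cd_subalgebra M4 (?\<Phi> ` U) \<and> dim (?\<Phi> ` U) = dim W \<and> cd_conjugate M4 (?\<Phi> ` U) W"
    if "oct_hom M3 \<sigma>" "map_prod \<sigma> \<sigma> ` U = W" "cd_subalgebra M4 W" for \<sigma> U W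
    using transported_conjugate[OF hom that(1,2)] cd_conjugate_transfer[OF _ that(3)] by blast
  have copy_id: "cd_subalgebra M4 (?\<Phi> ` W) \<and> dim (?\<Phi> ` W) = dim W \<and> cd_conjugate M4 (?\<Phi> ` W) W"
    if "cd_subalgebra M4 W" for W
    using copy[OF oct_hom_id _ that] by (simp add: prod.map_id)
  have 1: "\<forall>V \<in> {span {f0, f1, f4}, span {f0, f1, f5}, span {f0, f1, tf4}, span {f0, f1, tf5}}.
      cd_subalgebra M4 V \<and> dim V = 3 \<and> V \<sim>\<^sub>S S_3"
    using copy[OF oct_hom_std(1) std_span_S_3(1)] copy[OF oct_hom_std(2) std_span_S_3(2)]
      copy[OF oct_hom_std(3) std_span_S_3(3)] copy[OF oct_hom_std(4) std_span_S_3(4)] S_3_algebra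
    by (simp add: F flip: span)
  have 2: "\<forall>V \<in> {span {f0, f1, f6, f7}, span {f0, f1, tf0, tf1}, span {f0, f1, tf6, tf7}}.
      cd_subalgebra M4 V \<and> dim V = 4 \<and> V \<cong>\<^sub>S sed_H"
    using quaternionic_iso[OF quaternionic_aut[OF quaternionic_f6 aut]]
      quaternionic_iso[OF quaternionic_aut[OF quaternionic_tf0 aut]]
      quaternionic_iso[OF quaternionic_aut[OF quaternionic_tf6 aut]]
    by (simp add: F flip: span)
  have 3: "\<forall>V \<in> {span {f0, f1, f2, f3}}. cd_subalgebra M4 V \<and> dim V = 4 \<and> V \<sim>\<^sub>S S_4"
    using copy_id[OF S_4_algebra[THEN conjunct1]] S_4_algebra
    by (simp add: F S_4_def cd_one_def flip: span)
  have 4: "\<forall>V \<in> {span {f0, f1, f4, tf0, tf1, tf4}, span {f0, f1, f5, tf0, tf1, tf5}}.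
      cd_subalgebra M4 V \<and> dim V = 6 \<and> V \<sim>\<^sub>S S_6"
    using copy[OF oct_hom_std(1) std_span_S_6(1)] copy[OF oct_hom_std(2) std_span_S_6(2)]
      S_6_algebra
    by (simp add: F flip: span)
  have 5: "\<forall>V \<in> {span {f0, f1, f2, f3, f4, f5, f6, f7}, span {f0, f1, f6, f7, tf2, tf3, tf4, tf5}}.
      cd_subalgebra M4 V \<and> dim V = 8 \<and> V \<sim>\<^sub>S S_8"
    using copy[OF oct_hom_std(2) std_f5_span_S_8] copy[OF oct_hom_std(3) std_tf4_span_S_8]
      S_8_algebra
    by (simp add: F flip: span)
  have 6: "\<forall>V \<in> {span {f0, f1, f6, f7, tf0, tf1, tf6, tf7}}.
      cd_subalgebra M4 V \<and> dim V = 8 \<and> V \<sim>\<^sub>S O_ije"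
    using copy_id[OF O_ije_algebra[THEN conjunct1]] O_ije_algebra
    by (simp add: F flip: span span_O_ije)
  have 7: "\<forall>V \<in> {span {f0, f1, f2, f3, tf0, tf1, tf2, tf3}}.
      cd_subalgebra M4 V \<and> dim V = 8 \<and> V \<sim>\<^sub>S R_8"
    using copy_id[OF R_8_algebra[THEN conjunct1]] R_8_algebra
    by (simp add: F R_8_span flip: span)
  have mem: "f1 \<in> span (insert x (insert f1 B))" for x B
    by (rule span_base) simp
  show ?thesis
    using 1 2 3 4 5 6 7 by (simp add: mem)
qed

end
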